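(* Let $t$ be a purchase decision tree with leaf revenues $(r_{t,\ell})_{\ell \in \mathrm{leaves}(t)}$, and let $\mathbf{x} \in \{0,1\}^n$. Let $\ell^*$ denote the leaf of $t$ that the assortment $\{i : x_i = 1\}$ is mapped to. Define $\mathbf{y}_t$ by $y_{t,\ell} = 1$ if $\ell = \ell^*$ and $y_{t,\ell} = 0$ if $\ell \neq \ell^*$. Define $(\boldsymbol{\alpha}_t, \boldsymbol{\beta}_t, \gamma_t)$ by $$\alpha_{t,s} = \begin{cases} \max\{0, \max_{\ell \in \mathrm{left}(s)} r_{t,\ell} - r_{t,\ell^*}\} & \text{if } s \in \mathrm{RS}(\ell^* ),\\ 0 & \text{otherwise,}\end{cases}$$ $$\beta_{t,s} = \begin{cases} \max\{0, \max_{\ell \in \mathrm{right}(s)} r_{t,\ell} - r_{t,\ell^*}\} & \text{if } s \in \mathrm{LS}(\ell^* ),\\ 0 & \text{otherwise,}\end{cases}$$ $$\gamma_t = r_{t,\ell^*}.$$ Then: (a) $\mathbf{y}_t$ is a feasible solution to the primal subproblem (P); (b) $(\boldsymbol{\alpha}_t, \boldsymbol{\beta}_t, \gamma_t)$ is a feasible solution to the dual subproblem (D); and (c) $\mathbf{y}_t$ and $(\boldsymbol{\alpha}_t, \boldsymbol{\beta}_t, \gamma_t)$ are optimal for (P) and (D), respectively.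
   Context: Let $\mathcal{N} = \{1,\dots,n\}$ be the set of products and $0$ the no-purchase option, with revenues $\rho_i$ ($i \in \mathcal{N}$) and $\rho_0 = 0$. A purchase decision tree $t$ is a finite rooted binary tree in which every non-leaf node (called a split) has exactly one left child and one right child; $\mathrm{splits}(t)$ and $\mathrm{leaves}(t)$ are its sets of splits and leaves. Each split $s$ is labelled with a product $v(t,s) \in \mathcal{N}$ and each leaf $\ell$ with an option $c(t,\ell) \in \mathcal{N} \cup \{0\}$; $r_{t,\ell} = \rho_{c(t,\ell)}$. Standing assumption: if a split $s'$ is a descendant of a split $s$, then $v(t,s) \neq v(t,s')$. An assortment $S \subseteq \mathcal{N}$ is mapped to the leaf reached by starting at the root and, at each split $s$, moving to the left child if $v(t,s) \in S$ and to the right child otherwise. For a split $s$, $\mathrm{left}(s)$ (resp. $\mathrm{right}(s)$) is the set of leaves in the subtree rooted at the left (resp. right) child of $s$. For a leaf $\ell$, $\mathrm{LS}(\ell) = \{s \in \mathrm{splits}(t) : \ell \in \mathrm{left}(s)\}$ and $\mathrm{RS}(\ell) = \{s \in \mathrm{splits}(t) : \ell \in \mathrm{right}(s)\}$. Primal subproblem (P): maximize $\sum_{\ell \in \mathrm{leaves}(t)} r_{t,\ell}\, y_{t,\ell}$ subject to $\sum_{\ell \in \mathrm{leaves}(t)} y_{t,\ell} = 1$; $\ \sum_{\ell \in \mathrm{left}(s)} y_{t,\ell} \le x_{v(t,s)}$ for all $s \in \mathrm{splits}(t)$; $\ \sum_{\ell \in \mathrm{right}(s)} y_{t,\ell} \le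 1 - x_{v(t,s)}$ for all $s \in \mathrm{splits}(t)$; $\ y_{t,\ell} \ge 0$ for all $\ell \in \mathrm{leaves}(t)$. Dual subproblem (D): minimize $\sum_{s \in \mathrm{splits}(t)} x_{v(t,s)} \alpha_{t,s} + \sum_{s \in \mathrm{splits}(t)} (1 - x_{v(t,s)}) \beta_{t,s} + \gamma_t$ subject to $\sum_{s:\, \ell \in \mathrm{left}(s)} \alpha_{t,s} + \sum_{s:\, \ell \in \mathrm{right}(s)} \beta_{t,s} + \gamma_t \ge r_{t,\ell}$ for all $\ell \in \mathrm{leaves}(t)$; $\alpha_{t,s} \ge 0$, $\beta_{t,s} \ge 0$ for all $s \in \mathrm{splits}(t)$ ($\gamma_t$ free). *)

theory Defs
  imports Complex_Main "HOL-Library.Sublist"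
begin

text \<open>
  Options are natural numbers: the products are \<open>1, \<dots>, n\<close> and \<open>0\<close> is the no-purchase option.
\<close>

datatype dtree = Leaf nat | Split nat dtree dtree

datatype branch = L | R

text \<open>
  A node is the path leading to it from the root, so that nodes carrying equal labels
  (or equal subtrees) remain distinct.  A node is a proper descendant of another one iff the
  latter is a strict prefix of it.
\<close>

type_synonym node = "branch list"

fun splits :: "dtree \<Rightarrow> node set" where
  "splits (Leaf c) = {}"
| "splits (Split i u w) = {[]} \<union> (#) L ` splits u \<union> (#) R ` splits w"

fun leaves :: "dtree \<Rightarrow> node set" where
  "leaves (Leaf c) = {[]}"
| "leaves (Split i u w) = (#) L ` leaves u \<union> (#) R ` leaves w"

text \<open>
  The label of a node, used both for the product \<open>v(t,s)\<close> of a split \<open>s\<close> and for the option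
  \<open>c(t,\<ell>)\<close> of a leaf \<open>\<ell>\<close>.  The value at paths that are not nodes of the tree is irrelevant.
\<close>

fun label :: "dtree \<Rightarrow> node \<Rightarrow> nat" where
  "label (Leaf c) p = c"
| "label (Split i u w) [] = i"
| "label (Split i u w) (L # p) = label u p"
| "label (Split i u w) (R # p) = label w p"

definition purchase_tree :: "nat \<Rightarrow> dtree \<Rightarrow> bool" where
  "purchase_tree n t \<longleftrightarrow>
     (\<forall>s\<in>splits t. label t s \<in> {1..n}) \<and>
     (\<forall>l\<in>leaves t. label t l \<in> {0..n}) \<and>
     (\<forall>s\<in>splits t. \<forall>s'\<in>splits t. strict_prefix s s' \<longrightarrow> label t s \<noteq> label t s')"

fun mapped_leaf :: "dtree \<Rightarrow> nat set \<Rightarrow> node" where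
  "mapped_leaf (Leaf c) S = []"
| "mapped_leaf (Split i u w) S =
     (if i \<in> S then L # mapped_leaf u S else R # mapped_leaf w S)"

definition left_leaves :: "dtree \<Rightarrow> node \<Rightarrow> node set" where
  "left_leaves t s = {l \<in> leaves t. prefix (s @ [L]) l}"

definition right_leaves :: "dtree \<Rightarrow> node \<Rightarrow> node set" where
  "right_leaves t s = {l \<in> leaves t. prefix (s @ [R]) l}"

definition LS :: "dtree \<Rightarrow> node \<Rightarrow> node set" where
  "LS t l = {s \<in> splits t. l \<in> left_leaves t s}"

definition RS :: "dtree \<Rightarrow> node \<Rightarrow> node set" where
  "RS t l = {s \<in> splits t. l \<in> right_leaves t s}"

definition leaf_revenue :: "(nat \<Rightarrow> real) \<Rightarrow> dtree \<Rightarrow> node \<Rightarrow> real" where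
  "leaf_revenue \<rho> t l = \<rho> (label t l)"

definition primal_objective :: "(nat \<Rightarrow> real) \<Rightarrow> dtree \<Rightarrow> (node \<Rightarrow> real) \<Rightarrow> real" where
  "primal_objective \<rho> t y = (\<Sum>l\<in>leaves t. leaf_revenue \<rho> t l * y l)"

definition primal_feasible :: "dtree \<Rightarrow> (nat \<Rightarrow> real) \<Rightarrow> (node \<Rightarrow> real) \<Rightarrow> bool" where
  "primal_feasible t x y \<longleftrightarrow>
     (\<Sum>l\<in>leaves t. y l) = 1 \<and>
     (\<forall>s\<in>splits t. (\<Sum>l\<in>left_leaves t s. y l) \<le> x (label t s)) \<and>
     (\<forall>s\<in>splits t. (\<Sum>l\<in>right_leaves t s. y l) \<le> 1 - x (label t s)) \<and>
     (\<forall>l\<in>leaves t. y l \<ge> 0)"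

definition primal_optimal ::
    "(nat \<Rightarrow> real) \<Rightarrow> dtree \<Rightarrow> (nat \<Rightarrow> real) \<Rightarrow> (node \<Rightarrow> real) \<Rightarrow> bool" where
  "primal_optimal \<rho> t x y \<longleftrightarrow>
     primal_feasible t x y \<and>
     (\<forall>y'. primal_feasible t x y' \<longrightarrow> primal_objective \<rho> t y' \<le> primal_objective \<rho> t y)"

definition dual_objective ::
    "dtree \<Rightarrow> (nat \<Rightarrow> real) \<Rightarrow> (node \<Rightarrow> real) \<Rightarrow> (node \<Rightarrow> real) \<Rightarrow> real \<Rightarrow> real" where
  "dual_objective t x \<alpha> \<beta> \<gamma> =
     (\<Sum>s\<in>splits t. x (label t s) * \<alpha> s) + (\<Sum>s\<in>splits t. (1 - x (label t s)) * \<beta> s) + \<gamma>"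

definition dual_feasible ::
    "(nat \<Rightarrow> real) \<Rightarrow> dtree \<Rightarrow> (node \<Rightarrow> real) \<Rightarrow> (node \<Rightarrow> real) \<Rightarrow> real \<Rightarrow> bool" where
  "dual_feasible \<rho> t \<alpha> \<beta> \<gamma> \<longleftrightarrow>
     (\<forall>l\<in>leaves t. (\<Sum>s\<in>LS t l. \<alpha> s) + (\<Sum>s\<in>RS t l. \<beta> s) + \<gamma> \<ge> leaf_revenue \<rho> t l) \<and>
     (\<forall>s\<in>splits t. \<alpha> s \<ge> 0) \<and>
     (\<forall>s\<in>splits t. \<beta> s \<ge> 0)"

definition dual_optimal ::
    "(nat \<Rightarrow> real) \<Rightarrow> dtree \<Rightarrow> (nat \<Rightarrow> real) \<Rightarrow> (node \<Rightarrow> real) \<Rightarrow> (node \<Rightarrow> real) \<Rightarrow> real \<Rightarrow> bool"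
  where
  "dual_optimal \<rho> t x \<alpha> \<beta> \<gamma> \<longleftrightarrow>
     dual_feasible \<rho> t \<alpha> \<beta> \<gamma> \<and>
     (\<forall>\<alpha>' \<beta>' \<gamma>'. dual_feasible \<rho> t \<alpha>' \<beta>' \<gamma>' \<longrightarrow>
        dual_objective t x \<alpha> \<beta> \<gamma> \<le> dual_objective t x \<alpha>' \<beta>' \<gamma>')"

end

theory Submission
  imports Defs
begin

text \<open>
  For a binary \<open>x\<close>, the two primal bounds at a split are \<open>1\<close> on the side that the assortment takes
  there and \<open>0\<close> on the other side.  The leaf \<open>l*\<close> that the assortment is mapped to lies on the side
  taken at every split above it, so its indicator is feasible, with value \<open>r(l*)\<close>.

  For the dual, start from \<open>\<gamma> = r(l*)\<close>, which covers every leaf of revenue at most \<open>r(l*)\<close>.  Any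
  other leaf \<open>l\<close> separates from \<open>l*\<close> at some split \<open>s\<close> (\<open>leaves_separated\<close>): the two lie on
  opposite sides of \<open>s\<close>.  The multiplier attached to the side of \<open>s\<close> that \<open>l*\<close> avoids is at least the
  best revenue on that side minus \<open>r(l*)\<close>, so it alone makes up for the deficit \<open>r(l) - r(l*)\<close>.
  These multipliers are free of charge: they are positive only on the sides that the assortment
  does not take, and there the right-hand side of the primal constraint, which is the cost
  coefficient of the multiplier, is zero (\<open>mapped_leaf_left\<close>, \<open>mapped_leaf_right\<close>).  So the dual
  value is \<open>r(l*)\<close> as well, and \<open>weak_duality\<close> makes both solutions optimal.
\<close>

lemma finite_splits [simp]: "finite (splits t)"
  by (induction t) auto

lemma finite_leaves [simp]: "finite (leaves t)"
  by (induction t) auto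

lemma finite_left_leaves [simp]: "finite (left_leaves t s)"
  by (simp add: left_leaves_def)

lemma finite_right_leaves [simp]: "finite (right_leaves t s)"
  by (simp add: right_leaves_def)

lemma mapped_leaf_in_leaves: "mapped_leaf t S \<in> leaves t"
  by (induction t) auto

text \<open>
  The next two lemmas rule out that a leaf chosen by an assortment contradicts it anywhere on its
  path; this is where the primal constraints meet the branching rule.
\<close>

lemma mapped_leaf_left:
  assumes "s \<in> splits t" and "prefix (s @ [L]) (mapped_leaf t S)"
  shows "label t s \<in> S"
  using assms by (induction t arbitrary: s) (auto split: if_splits)

lemma mapped_leaf_right:
  assumes "s \<in> splits t" and "prefix (s @ [R]) (mapped_leaf t S)"
  shows "label t s \<notin> S"
  using assms by (induction t arbitrary: s) (auto split: if_splits)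

text \<open>
  Distinct leaves are separated by the deepest split above both of them.  In the induction, this is
  the root if the leaves lie in different subtrees, and otherwise it comes from their common subtree.
\<close>

lemma leaves_separated:
  assumes "l \<in> leaves t" and "l' \<in> leaves t" and "l \<noteq> l'"
  shows "\<exists>s\<in>splits t. l \<in> left_leaves t s \<and> l' \<in> right_leaves t s
                  \<or> l \<in> right_leaves t s \<and> l' \<in> left_leaves t s"
proof -
  have "\<exists>s\<in>splits t. prefix (s @ [L]) l \<and> prefix (s @ [R]) l'
                  \<or> prefix (s @ [R]) l \<and> prefix (s @ [L]) l'"
    using assms
  proof (induction t arbitrary: l l')
    case (Leaf c)
    then show ?case by simp
  next
    case (Split i u w)
    consider
        (LL) p p' where "l = L # p" "l' = L # p'" "p \<in> leaves u" "p' \<in> leaves u" "p \<noteq> p'"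
      | (RR) p p' where "l = R # p" "l' = R # p'" "p \<in> leaves w" "p' \<in> leaves w" "p \<noteq> p'"
      | (LR) p p' where "l = L # p \<and> l' = R # p' \<or> l = R # p \<and> l' = L # p'"
      using Split.prems by auto
    then show ?case
    proof cases
      case LL
      with Split.IH(1) obtain s where "s \<in> splits u"
        and "prefix (s @ [L]) p \<and> prefix (s @ [R]) p' \<or> prefix (s @ [R]) p \<and> prefix (s @ [L]) p'"
        by blast
      with LL show ?thesis by (intro bexI[of _ "L # s"]) auto
    next
      case RR
      with Split.IH(2) obtain s where "s \<in> splits w"
        and "prefix (s @ [L]) p \<and> prefix (s @ [R]) p' \<or> prefix (s @ [R]) p \<and> prefix (s @ [L]) p'"
        by blast
      with RR show ?thesis by (intro bexI[of _ "R # s"]) auto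
    next
      case LR
      then show ?thesis by (intro bexI[of _ "[]"]) auto
    qed
  qed
  then show ?thesis
    using assms by (auto simp: left_leaves_def right_leaves_def)
qed

text \<open>
  A leaf lies on the left of a split iff the split belongs to its \<open>LS\<close> set, so the constraint matrices
  of the two problems are transposes of each other.  Exchanging the order of summation over the pairs
  of a leaf and a split turns dual rows into primal rows; \<open>sum_RS_swap\<close> does the same on the right.
\<close>

lemma sum_LS_swap:
  fixes a y :: "node \<Rightarrow> real"
  shows "(\<Sum>l\<in>leaves t. (\<Sum>s\<in>LS t l. a s) * y l) = (\<Sum>s\<in>splits t. (\<Sum>l\<in>left_leaves t s. y l) * a s)"
proof -
  have "(\<Sum>l\<in>leaves t. \<Sum>s | s \<in> splits t \<and> prefix (s @ [L]) l. a s * y l)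
      = (\<Sum>s\<in>splits t. \<Sum>l | l \<in> leaves t \<and> prefix (s @ [L]) l. a s * y l)"
    by (rule sum.swap_restrict) auto
  then show ?thesis
    by (simp add: LS_def left_leaves_def sum_distrib_left sum_distrib_right mult.commute conj_commute
        cong: conj_cong)
qed

lemma sum_RS_swap:
  fixes b y :: "node \<Rightarrow> real"
  shows "(\<Sum>l\<in>leaves t. (\<Sum>s\<in>RS t l. b s) * y l) = (\<Sum>s\<in>splits t. (\<Sum>l\<in>right_leaves t s. y l) * b s)"
proof -
  have "(\<Sum>l\<in>leaves t. \<Sum>s | s \<in> splits t \<and> prefix (s @ [R]) l. b s * y l)
      = (\<Sum>s\<in>splits t. \<Sum>l | l \<in> leaves t \<and> prefix (s @ [R]) l. b s * y l)"
    by (rule sum.swap_restrict) auto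
  then show ?thesis
    by (simp add: RS_def right_leaves_def sum_distrib_left sum_distrib_right mult.commute conj_commute
        cong: conj_cong)
qed

text \<open>
  Weigh the dual constraint of each leaf by its primal mass, exchange the sums, and bound the mass on
  either side of each split by the primal constraint.
\<close>

lemma weak_duality:
  assumes P: "primal_feasible t x y" and D: "dual_feasible \<rho> t \<alpha> \<beta> \<gamma>"
  shows "primal_objective \<rho> t y \<le> dual_objective t x \<alpha> \<beta> \<gamma>"
proof -
  have "primal_objective \<rho> t y
      \<le> (\<Sum>l\<in>leaves t. ((\<Sum>s\<in>LS t l. \<alpha> s) + (\<Sum>s\<in>RS t l. \<beta> s) + \<gamma>) * y l)"
    unfolding primal_objective_def
    using P D by (intro sum_mono mult_right_mono) (auto simp: primal_feasible_def dual_feasible_def)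
  also have "\<dots> = (\<Sum>s\<in>splits t. (\<Sum>l\<in>left_leaves t s. y l) * \<alpha> s)
      + (\<Sum>s\<in>splits t. (\<Sum>l\<in>right_leaves t s. y l) * \<beta> s) + \<gamma> * (\<Sum>l\<in>leaves t. y l)"
    by (simp add: distrib_right sum.distrib sum_LS_swap sum_RS_swap sum_distrib_left)
  also have "\<dots> \<le> dual_objective t x \<alpha> \<beta> \<gamma>"
    unfolding dual_objective_def
    using P D
    by (intro add_mono sum_mono mult_right_mono) (auto simp: primal_feasible_def dual_feasible_def)
  finally show ?thesis .
qed

theorem theorem5:
  fixes n :: nat and \<rho> :: "nat \<Rightarrow> real" and t :: dtree and x :: "nat \<Rightarrow> real"
    and lstar :: node and y \<alpha> \<beta> :: "node \<Rightarrow> real" and \<gamma> :: real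
  assumes no_purchase_revenue: "\<rho> 0 = 0"
    and tree: "purchase_tree n t"
    and binary: "\<forall>i\<in>{1..n}. x i \<in> {0, 1}"
    and lstar: "lstar = mapped_leaf t {i \<in> {1..n}. x i = 1}"
    and y: "\<forall>l\<in>leaves t. y l = (if l = lstar then 1 else 0)"
    and \<alpha>: "\<forall>s\<in>splits t. \<alpha> s =
      (if s \<in> RS t lstar
       then max 0 (Max (leaf_revenue \<rho> t ` left_leaves t s) - leaf_revenue \<rho> t lstar)
       else 0)"
    and \<beta>: "\<forall>s\<in>splits t. \<beta> s =
      (if s \<in> LS t lstar
       then max 0 (Max (leaf_revenue \<rho> t ` right_leaves t s) - leaf_revenue \<rho> t lstar)
       else 0)"
    and \<gamma>: "\<gamma> = leaf_revenue \<rho> t lstar"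
  shows "primal_feasible t x y
    \<and> dual_feasible \<rho> t \<alpha> \<beta> \<gamma>
    \<and> primal_optimal \<rho> t x y \<and> dual_optimal \<rho> t x \<alpha> \<beta> \<gamma>"
proof -
  let ?S = "{i \<in> {1..n}. x i = 1}"
  let ?r = "leaf_revenue \<rho> t"
  have lstar_leaf: "lstar \<in> leaves t"
    by (simp add: lstar mapped_leaf_in_leaves)
  have label_range: "label t s \<in> {1..n}" if "s \<in> splits t" for s
    using tree that by (simp add: purchase_tree_def)
  have x_binary: "x (label t s) = 0 \<or> x (label t s) = 1" if "s \<in> splits t" for s
    using binary label_range[OF that] by blast
  have x_left: "x (label t s) = 1" if "s \<in> splits t" "lstar \<in> left_leaves t s" for s
    using mapped_leaf_left[of s t ?S] that by (simp add: left_leaves_def lstar)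
  have x_right: "x (label t s) = 0" if "s \<in> splits t" "lstar \<in> right_leaves t s" for s
    using mapped_leaf_right[of s t ?S] that x_binary[of s] label_range[of s]
    by (auto simp: right_leaves_def lstar)

  have sum_y: "(\<Sum>l\<in>A. y l) = (if lstar \<in> A then 1 else 0)" if "A \<subseteq> leaves t" for A
  proof -
    have "(\<Sum>l\<in>A. y l) = (\<Sum>l\<in>A. if l = lstar then 1 else 0)"
      using y that by (intro sum.cong) auto
    then show ?thesis
      using finite_subset[OF that] by simp
  qed
  have primal: "primal_feasible t x y"
    unfolding primal_feasible_def
  proof (intro conjI ballI)
    show "(\<Sum>l\<in>leaves t. y l) = 1"
      using sum_y[of "leaves t"] lstar_leaf by simp
    fix s assume s: "s \<in> splits t"
    show "(\<Sum>l\<in>left_leaves t s. y l) \<le> x (label t s)"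
      using sum_y[of "left_leaves t s"] x_left[OF s] x_binary[OF s] by (auto simp: left_leaves_def)
    show "(\<Sum>l\<in>right_leaves t s. y l) \<le> 1 - x (label t s)"
      using sum_y[of "right_leaves t s"] x_right[OF s] x_binary[OF s] by (auto simp: right_leaves_def)
  next
    fix l assume "l \<in> leaves t"
    then show "0 \<le> y l" using y by simp
  qed

  have \<alpha>_nonneg: "0 \<le> \<alpha> s" and \<beta>_nonneg: "0 \<le> \<beta> s" if "s \<in> splits t" for s
    using \<alpha> \<beta> that by auto
  have dual: "dual_feasible \<rho> t \<alpha> \<beta> \<gamma>"
    unfolding dual_feasible_def
  proof (intro conjI ballI)
    fix l assume l: "l \<in> leaves t"
    have LS_nonneg: "0 \<le> (\<Sum>s\<in>LS t l. \<alpha> s)"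
      by (intro sum_nonneg) (auto simp: LS_def \<alpha>_nonneg)
    have RS_nonneg: "0 \<le> (\<Sum>s\<in>RS t l. \<beta> s)"
      by (intro sum_nonneg) (auto simp: RS_def \<beta>_nonneg)
    show "?r l \<le> (\<Sum>s\<in>LS t l. \<alpha> s) + (\<Sum>s\<in>RS t l. \<beta> s) + \<gamma>"
    proof (cases "l = lstar")
      case True
      then show ?thesis using LS_nonneg RS_nonneg \<gamma> by simp
    next
      case False
      then obtain s where s: "s \<in> splits t"
        and sep: "l \<in> left_leaves t s \<and> lstar \<in> right_leaves t s
                \<or> l \<in> right_leaves t s \<and> lstar \<in> left_leaves t s"
        using leaves_separated[OF l lstar_leaf] by blast
      from sep show ?thesis
      proof
        assume *: "l \<in> left_leaves t s \<and> lstar \<in> right_leaves t s"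
        have "?r l \<le> Max (?r ` left_leaves t s)"
          using * by (intro Max_ge) auto
        moreover have "Max (?r ` left_leaves t s) - \<gamma> \<le> \<alpha> s"
          using \<alpha> \<gamma> s * by (simp add: RS_def)
        ultimately have "?r l - \<gamma> \<le> \<alpha> s" by simp
        also have "\<alpha> s \<le> (\<Sum>s\<in>LS t l. \<alpha> s)"
          using s * by (intro member_le_sum) (auto simp: LS_def \<alpha>_nonneg)
        finally show ?thesis using RS_nonneg by simp
      next
        assume *: "l \<in> right_leaves t s \<and> lstar \<in> left_leaves t s"
        have "?r l \<le> Max (?r ` right_leaves t s)"
          using * by (intro Max_ge) auto
        moreover have "Max (?r ` right_leaves t s) - \<gamma> \<le> \<beta> s"
          using \<beta> \<gamma> s * by (simp add: LS_def)
        ultimately have "?r l - \<gamma> \<le> \<beta> s" by simp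
        also have "\<beta> s \<le> (\<Sum>s\<in>RS t l. \<beta> s)"
          using s * by (intro member_le_sum) (auto simp: RS_def \<beta>_nonneg)
        finally show ?thesis using LS_nonneg by simp
      qed
    qed
  qed (simp_all add: \<alpha>_nonneg \<beta>_nonneg)

  have "primal_objective \<rho> t y = (\<Sum>l\<in>leaves t. if l = lstar then ?r l else 0)"
    unfolding primal_objective_def using y by (intro sum.cong) auto
  then have primal_value: "primal_objective \<rho> t y = ?r lstar"
    using lstar_leaf by simp
  \<comment> \<open>Complementary slackness: a multiplier is nonzero only on a side whose cost is zero.\<close>
  have slack: "x (label t s) * \<alpha> s = 0" "(1 - x (label t s)) * \<beta> s = 0" if "s \<in> splits t" for s
    using \<alpha> \<beta> x_left[OF that] x_right[OF that] that by (auto simp: LS_def RS_def)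
  have dual_value: "dual_objective t x \<alpha> \<beta> \<gamma> = ?r lstar"
    by (simp add: dual_objective_def \<gamma> slack del: mult_eq_0_iff)

  have "primal_optimal \<rho> t x y"
    unfolding primal_optimal_def
    using primal weak_duality[OF _ dual, of x] primal_value dual_value by simp
  moreover have "dual_optimal \<rho> t x \<alpha> \<beta> \<gamma>"
    unfolding dual_optimal_def
    using dual weak_duality[OF primal, of \<rho>] primal_value dual_value by simp
  ultimately show ?thesis
    using primal dual by blast
qed

end
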